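(* Let $(X,\tau_1,\tau_2)$ and $(Y,\gamma_1,\gamma_2)$ be bitopological spaces with $\tau_1\subset\tau_2$ and $\gamma_1\subset\gamma_2$. If $(X,\tau_1,\tau_2)$ is a $(2,1)$-$I$-space and $f:(X,\tau_1,\tau_2)\to(Y,\gamma_1,\gamma_2)$ is a $d$-closed or a $d$-open surjection, then $(Y,\gamma_1,\gamma_2)$ is also a $(2,1)$-$I$-space.
   Context: A bitopological space is a set with two topologies. For $A\subset X$, $A_i^d$ denotes the set of all $\tau_i$-accumulation points of $A$ in $X$, i.e. points $x\in X$ with $x\in\tau_i\mathrm{cl}(A\setminus\{x\})$, and $A_i^i=A\setminus A_i^d$, and similarly in $Y$; $A$ is $i$-discrete if every point of $A$ is $\tau_i$-isolated in $A$. A bitopological space $(X,\tau_1,\tau_2)$ is a $(2,1)$-$I$-space if its 1-derived set $X_1^d$ is $\tau_1$-closed and 2-discrete (i.e. every point of $X_1^d$ is $\tau_2$-isolated in $X_1^d$). $f$ is $d$-open ($d$-closed) if both $f:(X,\tau_1)\to(Y,\gamma_1)$ and $f:(X,\tau_2)\to(Y,\gamma_2)$ are open (closed) maps; continuity is not assumed. *)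

theory Defs
  imports "HOL-Analysis.Analysis"
begin

definition bitopological_space :: "'a set \<Rightarrow> 'a topology \<Rightarrow> 'a topology \<Rightarrow> bool" where
  "bitopological_space X \<tau>1 \<tau>2 \<longleftrightarrow> topspace \<tau>1 = X \<and> topspace \<tau>2 = X"

definition coarser_topology :: "'a topology \<Rightarrow> 'a topology \<Rightarrow> bool" where
  "coarser_topology \<tau> \<sigma> \<longleftrightarrow> {U. openin \<tau> U} \<subseteq> {U. openin \<sigma> U}"

text \<open>The set of accumulation points of \<open>A\<close> is the library's \<open>derived_set_of\<close>;
  the following lemma gives its description by closures.\<close>

lemma derived_set_of_iff_closure_of:
  "x \<in> \<tau> derived_set_of A \<longleftrightarrow> x \<in> \<tau> closure_of (A - {x})"
  by (auto simp: in_derived_set_of in_closure_of)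

definition isolated_points_of :: "'a topology \<Rightarrow> 'a set \<Rightarrow> 'a set"
    (infixl "isolated'_points'_of" 80) where
  "\<tau> isolated_points_of A = A - \<tau> derived_set_of A"

definition discrete_in :: "'a topology \<Rightarrow> 'a set \<Rightarrow> bool" where
  "discrete_in \<tau> A \<longleftrightarrow> (\<forall>x\<in>A. x \<in> \<tau> isolated_points_of A)"

definition I_space_21 :: "'a set \<Rightarrow> 'a topology \<Rightarrow> 'a topology \<Rightarrow> bool" where
  "I_space_21 X \<tau>1 \<tau>2 \<longleftrightarrow>
     bitopological_space X \<tau>1 \<tau>2 \<and>
     closedin \<tau>1 (\<tau>1 derived_set_of X) \<and>
     discrete_in \<tau>2 (\<tau>1 derived_set_of X)"

text \<open>The library's \<open>open_map\<close> and \<open>closed_map\<close> do not include continuity.\<close>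

definition d_open :: "'a topology \<Rightarrow> 'a topology \<Rightarrow> 'b topology \<Rightarrow> 'b topology \<Rightarrow> ('a \<Rightarrow> 'b) \<Rightarrow> bool" where
  "d_open \<tau>1 \<tau>2 \<gamma>1 \<gamma>2 f \<longleftrightarrow> open_map \<tau>1 \<gamma>1 f \<and> open_map \<tau>2 \<gamma>2 f"

definition d_closed :: "'a topology \<Rightarrow> 'a topology \<Rightarrow> 'b topology \<Rightarrow> 'b topology \<Rightarrow> ('a \<Rightarrow> 'b) \<Rightarrow> bool" where
  "d_closed \<tau>1 \<tau>2 \<gamma>1 \<gamma>2 f \<longleftrightarrow> closed_map \<tau>1 \<gamma>1 f \<and> closed_map \<tau>2 \<gamma>2 f"

end

theory Submission
  imports Defs
begin

text \<open>Write \<open>D\<close> for the 1-derived set of \<open>X\<close>, the complement of the set of points \<open>x\<close>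
  with \<open>{x}\<close> open; the derived set of a whole space is thus always closed. If \<open>f\<close> is open, it
  maps 1-isolated points to 1-isolated points, so the fibres over \<open>Y\<^sub>1\<^sup>d\<close> lie in \<open>D\<close>, and images of
  the 2-open sets isolating points of \<open>D\<close> isolate points of \<open>Y\<^sub>1\<^sup>d\<close>. If \<open>f\<close> is closed, then a point
  off \<open>f ` D\<close> has an open fibre and hence is isolated, so \<open>Y\<^sub>1\<^sup>d \<subseteq> f ` D\<close>; since \<open>D\<close> is 2-closed and
  2-discrete, all its subsets are 2-closed, and hence so are all subsets of \<open>f ` D\<close>.\<close>

lemma derived_set_of_topspace_eq:
  "\<tau> derived_set_of (topspace \<tau>) = topspace \<tau> - {x. openin \<tau> {x}}"
proof -
  have "x \<in> \<tau> derived_set_of (topspace \<tau>) \<longleftrightarrow> \<not> openin \<tau> {x}" if "x \<in> topspace \<tau>" for x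
  proof
    assume "x \<in> \<tau> derived_set_of (topspace \<tau>)"
    then show "\<not> openin \<tau> {x}"
      unfolding in_derived_set_of by blast
  next
    assume n: "\<not> openin \<tau> {x}"
    have "\<exists>y. y \<noteq> x \<and> y \<in> topspace \<tau> \<and> y \<in> U" if "x \<in> U" "openin \<tau> U" for U
    proof -
      have "U \<noteq> {x}" using n that(2) by blast
      then show ?thesis using that openin_subset by blast
    qed
    with \<open>x \<in> topspace \<tau>\<close> show "x \<in> \<tau> derived_set_of (topspace \<tau>)"
      unfolding in_derived_set_of by blast
  qed
  then show ?thesis
    using derived_set_of_subset_topspace[of \<tau> "topspace \<tau>"] by auto
qed

lemma closedin_derived_set_of_topspace:
  "closedin \<tau> (\<tau> derived_set_of (topspace \<tau>))"
proof -
  have "openin \<tau> {x. openin \<tau> {x}}"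
  proof (rule iffD2[OF openin_subopen], safe)
    fix x assume "openin \<tau> {x}"
    then show "\<exists>T. openin \<tau> T \<and> x \<in> T \<and> T \<subseteq> {x. openin \<tau> {x}}"
      by (intro exI[of _ "{x}"]) simp
  qed
  then show ?thesis
    by (simp add: derived_set_of_topspace_eq closedin_diff)
qed

lemma discrete_in_iff:
  "discrete_in \<tau> A \<longleftrightarrow> A \<inter> \<tau> derived_set_of A = {}"
  by (auto simp: discrete_in_def isolated_points_of_def)

text \<open>A closed set contains its derived set and a discrete set is disjoint from its own, so
  \<open>A\<close> has no accumulation points at all. By monotonicity neither has \<open>B\<close>,
  which is then closed.\<close>

lemma closedin_subset_of_closed_discrete:
  assumes "closedin \<tau> A" "discrete_in \<tau> A" "B \<subseteq> A"
  shows "closedin \<tau> B"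
proof -
  have "\<tau> derived_set_of B \<subseteq> \<tau> derived_set_of A"
    using assms(3) by (rule derived_set_of_mono)
  moreover have "\<tau> derived_set_of A = {}"
    using assms(1,2) by (auto simp: closedin_contains_derived_set discrete_in_iff)
  ultimately show ?thesis
    using assms(1,3) by (auto simp: closedin_contains_derived_set)
qed

text \<open>For \<open>y\<close> in \<open>A\<close> the subset \<open>A - {y}\<close> is its own
  closure, which therefore misses \<open>y\<close>. This is how discreteness is recovered on the
  image side of a closed map.\<close>

lemma discrete_in_if_subsets_closed:
  assumes "\<And>B. B \<subseteq> A \<Longrightarrow> closedin \<tau> B"
  shows "discrete_in \<tau> A"
proof -
  have "y \<notin> \<tau> derived_set_of A" if "y \<in> A" for y
  proof -
    have "\<tau> closure_of (A - {y}) = A - {y}"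
      by (intro closure_of_closedin assms) auto
    then show ?thesis
      by (simp add: derived_set_of_iff_closure_of)
  qed
  then show ?thesis
    by (auto simp: discrete_in_iff)
qed

lemma derived_set_of_topspace_open_map:
  assumes "open_map \<tau> \<gamma> f" "x \<in> topspace \<tau>"
    and "f x \<in> \<gamma> derived_set_of (topspace \<gamma>)"
  shows "x \<in> \<tau> derived_set_of (topspace \<tau>)"
proof (rule ccontr)
  assume "\<not> ?thesis"
  then have "openin \<tau> {x}"
    using assms(2) by (simp add: derived_set_of_topspace_eq)
  then have "openin \<gamma> {f x}"
    using assms(1) unfolding open_map_def by (metis image_empty image_insert)
  then show False
    using assms(3) by (simp add: derived_set_of_topspace_eq)
qed

lemma derived_set_of_topspace_closed_map:
  assumes "closed_map \<tau> \<gamma> f" "f ` topspace \<tau> = topspace \<gamma>"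
  shows "\<gamma> derived_set_of (topspace \<gamma>) \<subseteq> f ` (\<tau> derived_set_of (topspace \<tau>))"
proof
  fix y assume y: "y \<in> \<gamma> derived_set_of (topspace \<gamma>)"
  show "y \<in> f ` (\<tau> derived_set_of (topspace \<tau>))"
  proof (rule ccontr)
    assume n: "\<not> ?thesis"
    define F where "F = {x \<in> topspace \<tau>. f x = y}"
    \<comment> \<open>As \<open>y\<close> is not the image of any accumulation point, its fibre
      \<open>F\<close> consists of isolated points.\<close>
    have "openin \<tau> {x}" if "x \<in> F" for x
      using that n by (auto simp: F_def derived_set_of_topspace_eq)
    then have "openin \<tau> F"
      by (intro iffD2[OF openin_subopen] ballI exI[of _ "{_}"]) auto
    then have "closedin \<tau> (topspace \<tau> - F)"
      by (simp add: closedin_diff)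
    then have "closedin \<gamma> (f ` (topspace \<tau> - F))"
      using assms(1) by (simp add: closed_map_def)
    \<comment> \<open>Removing a whole fibre removes exactly \<open>y\<close> from the image, by
      surjectivity.\<close>
    also have "f ` (topspace \<tau> - F) = topspace \<gamma> - {y}"
      using assms(2) by (auto simp: F_def)
    finally have "openin \<gamma> {y}"
      using y by (subst openin_closedin_eq) (simp add: derived_set_of_topspace_eq)
    then show False
      using y by (simp add: derived_set_of_topspace_eq)
  qed
qed

lemma discrete_in_open_map_image:
  assumes "open_map \<tau> \<gamma> f" "discrete_in \<tau> D"
    and "E \<subseteq> f ` topspace \<tau>" "\<And>x. x \<in> topspace \<tau> \<Longrightarrow> f x \<in> E \<Longrightarrow> x \<in> D"
  shows "discrete_in \<gamma> E"
proof -
  have "y \<notin> \<gamma> derived_set_of E" if "y \<in> E" for y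
  proof -
    obtain x where x: "x \<in> topspace \<tau>" "y = f x"
      using \<open>y \<in> E\<close> assms(3) by blast
    then have "x \<in> D" "x \<notin> \<tau> derived_set_of D"
      using \<open>y \<in> E\<close> assms(2,4) by (auto simp: discrete_in_iff)
    then obtain V where V: "openin \<tau> V" "x \<in> V" "\<And>v. v \<in> V \<Longrightarrow> v \<in> D \<Longrightarrow> v = x"
      using x(1) by (auto simp: in_derived_set_of)
    have "openin \<gamma> (f ` V)"
      using assms(1) V(1) by (simp add: open_map_def)
    \<comment> \<open>A preimage of \<open>z\<close> in \<open>V\<close> lies in \<open>D\<close>
      because the fibres over \<open>E\<close> do; but \<open>V\<close> meets \<open>D\<close> only
      in \<open>x\<close>.\<close>
    moreover have "z = y" if "z \<in> E" "z \<in> f ` V" for z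
      using that V(3) assms(4) openin_subset[OF V(1)] x(2) by blast
    ultimately show ?thesis
      using V(2) x(2) unfolding in_derived_set_of by blast
  qed
  then show ?thesis
    by (auto simp: discrete_in_iff)
qed

theorem theorem3p30:
  fixes X :: "'a set" and \<tau>1 \<tau>2 :: "'a topology"
    and Y :: "'b set" and \<gamma>1 \<gamma>2 :: "'b topology"
    and f :: "'a \<Rightarrow> 'b"
  assumes "bitopological_space X \<tau>1 \<tau>2"
    and "bitopological_space Y \<gamma>1 \<gamma>2"
    and "coarser_topology \<tau>1 \<tau>2"
    and "coarser_topology \<gamma>1 \<gamma>2"
    and "I_space_21 X \<tau>1 \<tau>2"
    and "f ` X = Y"
    and "d_closed \<tau>1 \<tau>2 \<gamma>1 \<gamma>2 f \<or> d_open \<tau>1 \<tau>2 \<gamma>1 \<gamma>2 f"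
  shows "I_space_21 Y \<gamma>1 \<gamma>2"
proof -
  have top: "topspace \<tau>1 = X" "topspace \<tau>2 = X" "topspace \<gamma>1 = Y" "topspace \<gamma>2 = Y"
    using assms(1,2) by (auto simp: bitopological_space_def)
  let ?D = "\<tau>1 derived_set_of X" and ?E = "\<gamma>1 derived_set_of Y"
  have D: "closedin \<tau>1 ?D" "discrete_in \<tau>2 ?D"
    using assms(5) by (auto simp: I_space_21_def)
  have "discrete_in \<gamma>2 ?E"
    using assms(7)
  proof
    assume "d_closed \<tau>1 \<tau>2 \<gamma>1 \<gamma>2 f"
    then have f: "closed_map \<tau>1 \<gamma>1 f" "closed_map \<tau>2 \<gamma>2 f"
      by (auto simp: d_closed_def)
    \<comment> \<open>The derived set is closed in the coarser topology but discrete in the finer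
      one; \<open>\<tau>1 \<subseteq> \<tau>2\<close> brings both properties into
      \<open>\<tau>2\<close>.\<close>
    have "closedin \<tau>2 ?D"
      using D(1) assms(3) top by (auto simp: closedin_def coarser_topology_def)
    then have sub: "closedin \<tau>2 C" if "C \<subseteq> ?D" for C
      using D(2) that by (rule closedin_subset_of_closed_discrete)
    have E: "?E \<subseteq> f ` ?D"
      using derived_set_of_topspace_closed_map[OF f(1)] assms(6) by (simp add: top)
    show ?thesis
    proof (rule discrete_in_if_subsets_closed)
      fix B assume "B \<subseteq> ?E"
      then obtain C where "C \<subseteq> ?D" "B = f ` C"
        using E by (meson subset_imageE subset_trans)
      then show "closedin \<gamma>2 B"
        using f(2) sub by (simp add: closed_map_def)
    qed
  next
    assume "d_open \<tau>1 \<tau>2 \<gamma>1 \<gamma>2 f"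
    then have f: "open_map \<tau>1 \<gamma>1 f" "open_map \<tau>2 \<gamma>2 f"
      by (auto simp: d_open_def)
    \<comment> \<open>Openness is used twice: for the first topologies it puts the fibres over
      \<open>?E\<close> inside \<open>?D\<close>, for the second it carries the isolating
      neighbourhoods to \<open>Y\<close>.\<close>
    from f(2) D(2) show ?thesis
    proof (rule discrete_in_open_map_image)
      show "?E \<subseteq> f ` topspace \<tau>2"
        using derived_set_of_subset_topspace[of \<gamma>1 Y] assms(6) by (simp add: top)
      show "x \<in> ?D" if "x \<in> topspace \<tau>2" "f x \<in> ?E" for x
        using derived_set_of_topspace_open_map[OF f(1)] that by (simp add: top)
    qed
  qed
  then show ?thesis
    using assms(2) closedin_derived_set_of_topspace[of \<gamma>1]
    by (simp add: I_space_21_def top)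
qed

end
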